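(* $\mathcal{A}$ is closed in $\mathcal{L}^0_T$ if and only if, for each $t\in\{0,\dots,T\}$, $\mathcal{C}_t$ is closed (in $\mathcal{L}^0_t$).
   Context: Let $(\Omega,\mathcal{F},(\mathcal{F}_t)_{t=0,1,\dots,T},\mathbb{P})$ be a filtered probability space and $d\ge 1$ an integer (number of assets). $\mathcal{L}^0_t$ is the space of $\mathbb{R}^d$-valued $\mathcal{F}_t$-measurable random variables (identified when a.s. equal) with the topology of convergence in probability. $b\mathcal{F}^+_t$ is the set of bounded non-negative real-valued $\mathcal{F}_t$-measurable random variables. For a (suitably measurable) random set $S$, $\mathcal{L}^0(S;\mathcal{F}_t)$ is the set of $\mathcal{F}_t$-measurable random variables taking values a.s. in $S$. A $d\times d$ real matrix $\Pi$ is a bid-ask matrix if $\Pi^{ij}>0$, $\Pi^{ii}=1$ and $\Pi^{ij}\Pi^{jk}\ge\Pi^{ik}$ for all $i,j,k$. A bid-ask process is an adapted $\mathbb{R}^{d\times d}$-valued process $(\pi_t)_{t=0,\dots,T}$ with each $\pi_t$ a bid-ask matrix; fix one, $\pi$. For a matrix $\Pi$ let $K(\Pi)\subset\mathbb{R}^d$ be the convex cone spanned by the canonical basis vectors $e_i$ ($1\le i\le d$) and the vectors $\Pi^{ij}e_i-e_j$ ($1\le i,j\le d$). The time-$t$ trading cone is $-\mathcal{K}_t:=\mathcal{L}^0(-K(\pi_t);\mathcal{F}_t)$. The cone of claims attainable from zero endowment is $$\mathcal{A}:=(-\mathcal{K}_0)+\dots+(-\mathcal{K}_T)\subseteq\mathcal{L}^0_T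 .$$ For each $t$, $\mathcal{C}_t:=\{X\in\mathcal{L}^0_t:\ cX\in\mathcal{A}\text{ for all }c\in b\mathcal{F}^+_t\}$. *)

theory Defs
  imports "HOL-Probability.Probability"
begin

text \<open>
  Elements of the space L0 are represented by measurable functions rather than by their classes
  modulo almost sure equality. All sets of random variables below are closed under almost sure
  equality (within the measurable functions concerned), and so is every open set of
  \<open>L0_topology\<close>; hence closedness has the same meaning as in the quotient.
\<close>

definition L0 :: "'w measure \<Rightarrow> ('w \<Rightarrow> real^'d) set" where
  "L0 G = borel_measurable G"

text \<open>The topology of convergence in probability: the sets of all \<open>Y\<close> with
  \<open>P(\<bar>Y - X\<bar> > \<epsilon>) < \<epsilon>\<close>, for \<open>\<epsilon> > 0\<close>, form a neighbourhood base at \<open>X\<close>.\<close>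

definition L0_open :: "'w measure \<Rightarrow> 'w measure \<Rightarrow> ('w \<Rightarrow> real^'d) set \<Rightarrow> bool" where
  "L0_open M G U \<longleftrightarrow> U \<subseteq> L0 G \<and>
     (\<forall>X\<in>U. \<exists>\<epsilon>>0. \<forall>Y\<in>L0 G. measure M {\<omega>\<in>space M. norm (Y \<omega> - X \<omega>) > \<epsilon>} < \<epsilon> \<longrightarrow> Y \<in> U)"

definition L0_topology :: "'w measure \<Rightarrow> 'w measure \<Rightarrow> ('w \<Rightarrow> real^'d) topology" where
  "L0_topology M G = topology (L0_open M G)"

definition bid_ask_matrix :: "real^'d^'d \<Rightarrow> bool" where
  "bid_ask_matrix \<Lambda> \<longleftrightarrow> (\<forall>i j. \<Lambda>$i$j > 0) \<and> (\<forall>i. \<Lambda>$i$i = 1) \<and>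
     (\<forall>i j k. \<Lambda>$i$j * \<Lambda>$j$k \<ge> \<Lambda>$i$k)"

definition solvency_cone :: "real^'d^'d \<Rightarrow> (real^'d) set" where
  "solvency_cone \<Lambda> = convex_cone hull
     ({axis i 1 | i. True} \<union> {\<Lambda>$i$j *\<^sub>R axis i 1 - axis j 1 | i j. True})"

definition finite_filtration :: "'w measure \<Rightarrow> nat \<Rightarrow> (nat \<Rightarrow> 'w measure) \<Rightarrow> bool" where
  "finite_filtration M T F \<longleftrightarrow> (\<forall>t\<le>T. subalgebra M (F t)) \<and>
     (\<forall>s t. s \<le> t \<and> t \<le> T \<longrightarrow> subalgebra (F t) (F s))"

definition bid_ask_process ::
    "'w measure \<Rightarrow> nat \<Rightarrow> (nat \<Rightarrow> 'w measure) \<Rightarrow> (nat \<Rightarrow> 'w \<Rightarrow> real^'d^'d) \<Rightarrow> bool" where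
  "bid_ask_process M T F \<pi> \<longleftrightarrow>
     (\<forall>t\<le>T. \<pi> t \<in> borel_measurable (F t) \<and> (\<forall>\<omega>\<in>space M. bid_ask_matrix (\<pi> t \<omega>)))"

definition L0_selections ::
    "'w measure \<Rightarrow> 'w measure \<Rightarrow> ('w \<Rightarrow> (real^'d) set) \<Rightarrow> ('w \<Rightarrow> real^'d) set" where
  "L0_selections M G S = {X \<in> L0 G. AE \<omega> in M. X \<omega> \<in> S \<omega>}"

text \<open>The cone written \<open>-\<K>\<^sub>t\<close> in the literature; the minus sign is part of the definition.\<close>

definition trading_cone :: "'w measure \<Rightarrow> (nat \<Rightarrow> 'w measure) \<Rightarrow> (nat \<Rightarrow> 'w \<Rightarrow> real^'d^'d) \<Rightarrow>
    nat \<Rightarrow> ('w \<Rightarrow> real^'d) set" where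
  "trading_cone M F \<pi> t = L0_selections M (F t) (\<lambda>\<omega>. uminus ` solvency_cone (\<pi> t \<omega>))"

definition attainable :: "'w measure \<Rightarrow> nat \<Rightarrow> (nat \<Rightarrow> 'w measure) \<Rightarrow>
    (nat \<Rightarrow> 'w \<Rightarrow> real^'d^'d) \<Rightarrow> ('w \<Rightarrow> real^'d) set" where
  "attainable M T F \<pi> = {X \<in> L0 (F T). \<exists>\<xi>. (\<forall>t\<le>T. \<xi> t \<in> trading_cone M F \<pi> t) \<and>
     (AE \<omega> in M. X \<omega> = (\<Sum>t\<le>T. \<xi> t \<omega>))}"

definition bounded_nonneg :: "'w measure \<Rightarrow> ('w \<Rightarrow> real) set" where
  "bounded_nonneg G = {c \<in> borel_measurable G. (\<forall>\<omega>\<in>space G. 0 \<le> c \<omega>) \<and>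
     (\<exists>B. \<forall>\<omega>\<in>space G. c \<omega> \<le> B)}"

definition scalable_claims :: "'w measure \<Rightarrow> nat \<Rightarrow> (nat \<Rightarrow> 'w measure) \<Rightarrow>
    (nat \<Rightarrow> 'w \<Rightarrow> real^'d^'d) \<Rightarrow> nat \<Rightarrow> ('w \<Rightarrow> real^'d) set" where
  "scalable_claims M T F \<pi> t = {X \<in> L0 (F t).
     \<forall>c\<in>bounded_nonneg (F t). (\<lambda>\<omega>. c \<omega> *\<^sub>R X \<omega>) \<in> attainable M T F \<pi>}"


text \<open>\<open>L0_open\<close> is a topology on L0, and its limits are the limits in probability.\<close>

context
  fixes M G :: "'w measure"
  assumes prob: "prob_space M" and sub: "subalgebra M G"
begin

interpretation prob_space M by (rule prob)

lemma L0_diff_sets: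
  fixes X Y :: "'w \<Rightarrow> real^'d"
  assumes "X \<in> L0 G" "Y \<in> L0 G"
  shows "{\<omega>\<in>space M. norm (Y \<omega> - X \<omega>) > e} \<in> sets M"
proof -
  have [measurable]: "X \<in> borel_measurable M" "Y \<in> borel_measurable M"
    using assms measurable_from_subalg[OF sub] by (auto simp: L0_def)
  show ?thesis by measurable
qed

lemma L0_diff_mono:
  fixes X Y :: "'w \<Rightarrow> real^'d"
  assumes "X \<in> L0 G" "Y \<in> L0 G" "d \<le> e"
  shows "measure M {\<omega>\<in>space M. norm (Y \<omega> - X \<omega>) > e}
           \<le> measure M {\<omega>\<in>space M. norm (Y \<omega> - X \<omega>) > d}"
  using assms by (intro finite_measure_mono L0_diff_sets) auto

lemma L0_diff_triangle:
  fixes X Y Z :: "'w \<Rightarrow> real^'d"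
  assumes "X \<in> L0 G" "Y \<in> L0 G" "Z \<in> L0 G"
  shows "measure M {\<omega>\<in>space M. norm (Z \<omega> - X \<omega>) > d + e}
           \<le> measure M {\<omega>\<in>space M. norm (Z \<omega> - Y \<omega>) > d}
             + measure M {\<omega>\<in>space M. norm (Y \<omega> - X \<omega>) > e}"
proof -
  have "{\<omega>\<in>space M. norm (Z \<omega> - X \<omega>) > d + e}
          \<subseteq> {\<omega>\<in>space M. norm (Z \<omega> - Y \<omega>) > d} \<union> {\<omega>\<in>space M. norm (Y \<omega> - X \<omega>) > e}"
  proof
    fix \<omega> assume "\<omega> \<in> {\<omega>\<in>space M. norm (Z \<omega> - X \<omega>) > d + e}"
    moreover have "norm (Z \<omega> - X \<omega>) \<le> norm (Z \<omega> - Y \<omega>) + norm (Y \<omega> - X \<omega>)"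
      using norm_triangle_ineq[of "Z \<omega> - Y \<omega>" "Y \<omega> - X \<omega>"] by simp
    ultimately show "\<omega> \<in> {\<omega>\<in>space M. norm (Z \<omega> - Y \<omega>) > d} \<union> {\<omega>\<in>space M. norm (Y \<omega> - X \<omega>) > e}"
      by auto
  qed
  then have "measure M {\<omega>\<in>space M. norm (Z \<omega> - X \<omega>) > d + e}
      \<le> measure M ({\<omega>\<in>space M. norm (Z \<omega> - Y \<omega>) > d} \<union> {\<omega>\<in>space M. norm (Y \<omega> - X \<omega>) > e})"
    by (intro finite_measure_mono sets.Un L0_diff_sets assms)
  also have "\<dots> \<le> measure M {\<omega>\<in>space M. norm (Z \<omega> - Y \<omega>) > d}
             + measure M {\<omega>\<in>space M. norm (Y \<omega> - X \<omega>) > e}"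
    by (intro measure_Un_le L0_diff_sets assms)
  finally show ?thesis .
qed

lemma istopology_L0_open: "istopology (L0_open M G :: ('w \<Rightarrow> real^'d) set \<Rightarrow> bool)"
  unfolding istopology_def
proof (intro conjI allI impI)
  fix U V :: "('w \<Rightarrow> real^'d) set"
  assume U: "L0_open M G U" and V: "L0_open M G V"
  show "L0_open M G (U \<inter> V)"
    unfolding L0_open_def
  proof (intro conjI ballI)
    show "U \<inter> V \<subseteq> L0 G" using U by (auto simp: L0_open_def)
    fix X assume X: "X \<in> U \<inter> V"
    then have XL: "X \<in> L0 G" using U by (auto simp: L0_open_def)
    obtain d where d: "d > 0"
      "\<And>Y. Y \<in> L0 G \<Longrightarrow> measure M {\<omega>\<in>space M. norm (Y \<omega> - X \<omega>) > d} < d \<Longrightarrow> Y \<in> U"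
      using U X unfolding L0_open_def by blast
    obtain e where e: "e > 0"
      "\<And>Y. Y \<in> L0 G \<Longrightarrow> measure M {\<omega>\<in>space M. norm (Y \<omega> - X \<omega>) > e} < e \<Longrightarrow> Y \<in> V"
      using V X unfolding L0_open_def by blast
    show "\<exists>\<epsilon>>0. \<forall>Y\<in>L0 G. measure M {\<omega>\<in>space M. norm (Y \<omega> - X \<omega>) > \<epsilon>} < \<epsilon> \<longrightarrow> Y \<in> U \<inter> V"
    proof (intro exI[of _ "min d e"] conjI ballI impI)
      fix Y :: "'w \<Rightarrow> real^'d" assume Y: "Y \<in> L0 G"
        and lt: "measure M {\<omega>\<in>space M. norm (Y \<omega> - X \<omega>) > min d e} < min d e"
      have "Y \<in> U" using d(2)[OF Y] L0_diff_mono[OF XL Y, of "min d e" d] lt by linarith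
      moreover have "Y \<in> V" using e(2)[OF Y] L0_diff_mono[OF XL Y, of "min d e" e] lt by linarith
      ultimately show "Y \<in> U \<inter> V" by blast
    qed (use d e in auto)
  qed
next
  fix \<U> :: "('w \<Rightarrow> real^'d) set set" assume *: "\<forall>U\<in>\<U>. L0_open M G U"
  show "L0_open M G (\<Union>\<U>)"
    unfolding L0_open_def
  proof (intro conjI ballI)
    show "\<Union>\<U> \<subseteq> L0 G" using * by (auto simp: L0_open_def)
    fix X assume "X \<in> \<Union>\<U>"
    then obtain U where U: "U \<in> \<U>" "X \<in> U" by blast
    then obtain e where "e > 0"
      "\<forall>Y\<in>L0 G. measure M {\<omega>\<in>space M. norm (Y \<omega> - X \<omega>) > e} < e \<longrightarrow> Y \<in> U"
      using * unfolding L0_open_def by blast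
    then show "\<exists>\<epsilon>>0. \<forall>Y\<in>L0 G. measure M {\<omega>\<in>space M. norm (Y \<omega> - X \<omega>) > \<epsilon>} < \<epsilon> \<longrightarrow> Y \<in> \<Union>\<U>"
      using U by blast
  qed
qed

lemma openin_L0_topology: "openin (L0_topology M G) U \<longleftrightarrow> L0_open M G U"
  unfolding L0_topology_def by (simp add: topology_inverse'[OF istopology_L0_open])

lemma topspace_L0_topology: "topspace (L0_topology M G) = L0 G"
proof
  show "topspace (L0_topology M G) \<subseteq> L0 G"
    using openin_topspace[of "L0_topology M G"] unfolding openin_L0_topology L0_open_def by blast
  have "openin (L0_topology M G) (L0 G)"
    unfolding openin_L0_topology L0_open_def by (auto intro: exI[of _ 1])
  then show "L0 G \<subseteq> topspace (L0_topology M G)" by (rule openin_subset)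
qed

lemma limitin_L0_topology:
  fixes X :: "'w \<Rightarrow> real^'d" and Y :: "nat \<Rightarrow> 'w \<Rightarrow> real^'d"
  assumes X: "X \<in> L0 G" and Y: "\<And>n. Y n \<in> L0 G"
  shows "limitin (L0_topology M G) Y X sequentially \<longleftrightarrow>
    (\<forall>\<epsilon>>0. (\<lambda>n. measure M {\<omega>\<in>space M. norm (Y n \<omega> - X \<omega>) > \<epsilon>}) \<longlonglongrightarrow> 0)"
proof
  assume lim: "limitin (L0_topology M G) Y X sequentially"
  have near: "eventually (\<lambda>n. measure M {\<omega>\<in>space M. norm (Y n \<omega> - X \<omega>) > e} < e) sequentially"
    if e: "e > 0" for e
  proof -
    define U where "U = {V \<in> L0 G. \<exists>d>0. \<forall>Z\<in>L0 G.
      measure M {\<omega>\<in>space M. norm (Z \<omega> - V \<omega>) > d} < d \<longrightarrow>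
      measure M {\<omega>\<in>space M. norm (Z \<omega> - X \<omega>) > e} < e}"
    have "L0_open M G U"
      unfolding L0_open_def
    proof (intro conjI ballI)
      show "U \<subseteq> L0 G" by (auto simp: U_def)
      fix V assume "V \<in> U"
      then obtain d where V: "V \<in> L0 G" and d: "d > 0" "\<And>Z. Z \<in> L0 G \<Longrightarrow>
        measure M {\<omega>\<in>space M. norm (Z \<omega> - V \<omega>) > d} < d \<Longrightarrow>
        measure M {\<omega>\<in>space M. norm (Z \<omega> - X \<omega>) > e} < e"
        unfolding U_def by blast
      show "\<exists>\<epsilon>>0. \<forall>W\<in>L0 G. measure M {\<omega>\<in>space M. norm (W \<omega> - V \<omega>) > \<epsilon>} < \<epsilon> \<longrightarrow> W \<in> U"
      proof (intro exI[of _ "d/2"] conjI ballI impI)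
        fix W :: "'w \<Rightarrow> real^'d" assume W: "W \<in> L0 G"
          and WV: "measure M {\<omega>\<in>space M. norm (W \<omega> - V \<omega>) > d/2} < d/2"
        have "measure M {\<omega>\<in>space M. norm (Z \<omega> - X \<omega>) > e} < e"
          if Z: "Z \<in> L0 G" and ZW: "measure M {\<omega>\<in>space M. norm (Z \<omega> - W \<omega>) > d/2} < d/2" for Z
        proof (rule d(2)[OF Z])
          show "measure M {\<omega>\<in>space M. norm (Z \<omega> - V \<omega>) > d} < d"
            using L0_diff_triangle[OF V W Z, of "d/2" "d/2"] ZW WV by simp
        qed
        then show "W \<in> U" unfolding U_def using W d(1) by (auto intro!: exI[of _ "d/2"])
      qed (use d in auto)
    qed
    moreover have "X \<in> U" unfolding U_def using X e by auto
    ultimately have "eventually (\<lambda>n. Y n \<in> U) sequentially"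
      using lim unfolding limitin_def openin_L0_topology by blast
    then show ?thesis
    proof (rule eventually_mono)
      fix n assume "Y n \<in> U"
      then obtain d where "d > 0" "\<forall>Z\<in>L0 G.
        measure M {\<omega>\<in>space M. norm (Z \<omega> - Y n \<omega>) > d} < d \<longrightarrow>
        measure M {\<omega>\<in>space M. norm (Z \<omega> - X \<omega>) > e} < e"
        unfolding U_def by blast
      then show "measure M {\<omega>\<in>space M. norm (Y n \<omega> - X \<omega>) > e} < e"
        using Y[of n] by (auto dest!: bspec[of _ _ "Y n"])
    qed
  qed
  show "\<forall>\<epsilon>>0. (\<lambda>n. measure M {\<omega>\<in>space M. norm (Y n \<omega> - X \<omega>) > \<epsilon>}) \<longlonglongrightarrow> 0"
  proof (intro allI impI, rule order_tendstoI)
    fix e a :: real assume "e > 0" "0 < a"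
    then have "eventually (\<lambda>n. measure M {\<omega>\<in>space M. norm (Y n \<omega> - X \<omega>) > min e a} < min e a) sequentially"
      by (intro near) auto
    then show "eventually (\<lambda>n. measure M {\<omega>\<in>space M. norm (Y n \<omega> - X \<omega>) > e} < a) sequentially"
    proof (rule eventually_mono)
      fix n assume "measure M {\<omega>\<in>space M. norm (Y n \<omega> - X \<omega>) > min e a} < min e a"
      then show "measure M {\<omega>\<in>space M. norm (Y n \<omega> - X \<omega>) > e} < a"
        using L0_diff_mono[OF X Y[of n], of "min e a" e] by linarith
    qed
  next
    fix e a :: real assume "a < 0"
    then show "eventually (\<lambda>n. a < measure M {\<omega>\<in>space M. norm (Y n \<omega> - X \<omega>) > e}) sequentially"
      by (intro always_eventually allI) (rule less_le_trans, auto)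
  qed
next
  assume lim: "\<forall>\<epsilon>>0. (\<lambda>n. measure M {\<omega>\<in>space M. norm (Y n \<omega> - X \<omega>) > \<epsilon>}) \<longlonglongrightarrow> 0"
  show "limitin (L0_topology M G) Y X sequentially"
    unfolding limitin_def openin_L0_topology topspace_L0_topology
  proof (intro conjI allI impI X)
    fix U assume U: "L0_open M G U \<and> X \<in> U"
    then obtain e where e: "e > 0"
      "\<forall>Z\<in>L0 G. measure M {\<omega>\<in>space M. norm (Z \<omega> - X \<omega>) > e} < e \<longrightarrow> Z \<in> U"
      unfolding L0_open_def by blast
    have "eventually (\<lambda>n. measure M {\<omega>\<in>space M. norm (Y n \<omega> - X \<omega>) > e} < e) sequentially"
      using lim e(1) by (auto intro: order_tendstoD)
    then show "eventually (\<lambda>n. Y n \<in> U) sequentially"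
      by (rule eventually_mono) (use e(2) Y in blast)
  qed
qed

end

end

theory Submission
  imports Defs
begin

text \<open>
  Since \<open>-\<K>\<^sub>t \<subseteq> \<C>\<^sub>t \<subseteq> \<A>\<close>, the cone \<open>\<A>\<close> is the sum of the \<open>\<C>\<^sub>t\<close>, and if these are closed then the
  tails \<open>\<C>\<^sub>t + \<dots> + \<C>\<^sub>T\<close> are closed by backward induction on \<open>t\<close>. The point is that the sum
  \<open>\<C>\<^sub>t + (\<C>\<^bsub>t+1\<^esub> + \<dots> + \<C>\<^sub>T)\<close> has only reversible null strategies: if \<open>\<xi> \<in> \<C>\<^sub>t\<close> and \<open>-\<xi>\<close> lies in the
  later tail, then \<open>-\<xi> \<in> \<C>\<^sub>t\<close>, and \<open>c \<xi> = K \<xi> + (K - c) (-\<xi>)\<close> for \<open>0 \<le> c \<le> K\<close> shows that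
  \<open>\<xi> \<in> \<C>\<^bsub>t+1\<^esub>\<close>. Diverging parts of an approximating sequence can therefore be projected away
  along random null directions, as in the Kabanov-Stricker elimination argument. Conversely,
  multiplication by a bounded \<open>c\<close> is continuous, so closedness passes from \<open>\<A>\<close> to \<open>\<C>\<^sub>t\<close>.
\<close>

section \<open>Closedness in probability through almost sure limits\<close>

text \<open>Almost sure limits replace limits in probability, so that extraction, projection and
  gluing can be carried out point by point. Constant sequences show that such a set also absorbs
  almost sure equality within \<open>L0 G\<close>.\<close>

definition ae_closed :: "'w measure \<Rightarrow> 'w measure \<Rightarrow> ('w \<Rightarrow> real^'d) set \<Rightarrow> bool" where
  "ae_closed M G D \<longleftrightarrow> D \<subseteq> L0 G \<and>
     (\<forall>X\<in>L0 G. \<forall>Y. (\<forall>n. Y n \<in> D) \<longrightarrow> (AE \<omega> in M. (\<lambda>n. Y n \<omega>) \<longlonglongrightarrow> X \<omega>) \<longrightarrow> X \<in> D)"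

lemma ae_closedD:
  assumes "ae_closed M G D" "X \<in> L0 G" "\<And>n. Y n \<in> D" "AE \<omega> in M. (\<lambda>n. Y n \<omega>) \<longlonglongrightarrow> X \<omega>"
  shows "X \<in> D"
  using assms unfolding ae_closed_def by blast

lemma ae_closed_AE_eq:
  assumes "ae_closed M G D" "Y \<in> D" "X \<in> L0 G" "AE \<omega> in M. X \<omega> = Y \<omega>"
  shows "X \<in> D"
  using assms(1,3) by (rule ae_closedD[where Y = "\<lambda>_. Y"]) (use assms in auto)

text \<open>At almost every point the indicator of the deviation set is eventually 0, and dominated
  convergence with the constant bound 1 carries this over to the probabilities.\<close>

lemma AE_tendsto_in_measure:
  fixes X :: "'w \<Rightarrow> real^'d"
  assumes "prob_space M" "X \<in> borel_measurable M" "\<And>n. Y n \<in> borel_measurable M"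
    and lim: "AE \<omega> in M. (\<lambda>n. Y n \<omega>) \<longlonglongrightarrow> X \<omega>" and "e > 0"
  shows "(\<lambda>n. measure M {\<omega>\<in>space M. norm (Y n \<omega> - X \<omega>) > e}) \<longlonglongrightarrow> 0"
proof -
  interpret prob_space M by fact
  note [measurable] = assms(2,3)
  let ?A = "\<lambda>n. {\<omega>\<in>space M. norm (Y n \<omega> - X \<omega>) > e}"
  have "(\<lambda>n. \<integral>\<omega>. indicator (?A n) \<omega> \<partial>M) \<longlonglongrightarrow> (\<integral>\<omega>. (0::real) \<partial>M)"
  proof (rule integral_dominated_convergence[where w = "\<lambda>_. 1"])
    show "AE \<omega> in M. (\<lambda>n. indicator (?A n) \<omega>) \<longlonglongrightarrow> (0::real)"
      using lim
    proof eventually_elim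
      fix \<omega> assume "(\<lambda>n. Y n \<omega>) \<longlonglongrightarrow> X \<omega>"
      then have "eventually (\<lambda>n. norm (Y n \<omega> - X \<omega>) < e) sequentially"
        using \<open>e > 0\<close> by (simp add: tendsto_iff dist_norm)
      then show "(\<lambda>n. indicator (?A n) \<omega>) \<longlonglongrightarrow> (0::real)"
        by (intro tendsto_eventually) (auto elim!: eventually_mono)
    qed
  qed (auto simp: indicator_def)
  then show ?thesis by simp
qed

text \<open>Borel-Cantelli: the geometric bounds are summable, so almost every point lies in only
  finitely many deviation sets, and beyond these the error is at most
  \<open>(1/2)^n\<close>.\<close>

lemma AE_tendsto_fast:
  fixes X :: "'w \<Rightarrow> real^'d"
  assumes "prob_space M" "X \<in> borel_measurable M" "\<And>n. Y n \<in> borel_measurable M"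
    and fast: "\<And>n. measure M {\<omega>\<in>space M. norm (Y n \<omega> - X \<omega>) > (1/2)^n} \<le> (1/2)^n"
  shows "AE \<omega> in M. (\<lambda>n. Y n \<omega>) \<longlonglongrightarrow> X \<omega>"
proof -
  interpret prob_space M by fact
  note [measurable] = assms(2,3)
  let ?A = "\<lambda>n. {\<omega>\<in>space M. norm (Y n \<omega> - X \<omega>) > (1/2)^n}"
  have "summable (\<lambda>n. measure M (?A n))"
    by (rule summable_comparison_test'[where g = "\<lambda>n. (1/2)^n" and N = 0])
      (use fast in \<open>auto simp: summable_geometric\<close>)
  then have "AE \<omega> in M. eventually (\<lambda>n. \<omega> \<in> space M - ?A n) sequentially"
    by (intro borel_cantelli_AE1) (auto simp: less_top[symmetric])
  then show ?thesis
  proof eventually_elim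
    fix \<omega> assume "eventually (\<lambda>n. \<omega> \<in> space M - ?A n) sequentially"
    then have "eventually (\<lambda>n. norm (Y n \<omega> - X \<omega>) \<le> (1/2)^n) sequentially"
      by eventually_elim auto
    then have "(\<lambda>n. Y n \<omega> - X \<omega>) \<longlonglongrightarrow> 0"
      by (rule Lim_null_comparison) (simp add: LIMSEQ_realpow_zero)
    then show "(\<lambda>n. Y n \<omega>) \<longlonglongrightarrow> X \<omega>"
      by (simp add: LIM_zero_iff)
  qed
qed

lemma L0_borel_measurable:
  "subalgebra M G \<Longrightarrow> X \<in> L0 G \<Longrightarrow> X \<in> borel_measurable M"
  unfolding L0_def by (rule measurable_from_subalg)

text \<open>Topologically closed sets contain their limits in probability, hence their almost sure
  limits. Conversely, if the complement of \<open>D\<close> were not open at \<open>X\<close>, the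
  radii \<open>(1/2)^n\<close> would supply points of \<open>D\<close> converging to
  \<open>X\<close> fast enough to converge almost surely.\<close>

lemma closedin_L0_iff_ae_closed:
  fixes D :: "('w \<Rightarrow> real^'d) set"
  assumes prob: "prob_space M" and sub: "subalgebra M G"
  shows "closedin (L0_topology M G) D \<longleftrightarrow> ae_closed M G D"
proof
  assume cl: "closedin (L0_topology M G) D"
  then have D: "D \<subseteq> L0 G"
    using closedin_subset topspace_L0_topology[OF prob sub] by blast
  show "ae_closed M G D"
    unfolding ae_closed_def
  proof (intro conjI ballI allI impI D)
    fix X Y assume X: "X \<in> L0 G" and Y: "\<forall>n. Y n \<in> D"
      and lim: "AE \<omega> in M. (\<lambda>n. Y n \<omega>) \<longlonglongrightarrow> X \<omega>"
    have "limitin (L0_topology M G) Y X sequentially"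
    proof (subst limitin_L0_topology[OF prob sub])
      show "\<forall>\<epsilon>>0. (\<lambda>n. measure M {\<omega>\<in>space M. norm (Y n \<omega> - X \<omega>) > \<epsilon>}) \<longlonglongrightarrow> 0"
        using X Y D lim
        by (intro allI impI AE_tendsto_in_measure[OF prob] L0_borel_measurable[OF sub]) auto
    qed (use X Y D in auto)
    then show "X \<in> D"
      by (rule limitin_closedin[OF _ cl]) (use Y in auto)
  qed
next
  assume cl: "ae_closed M G D"
  then have D: "D \<subseteq> L0 G" by (simp add: ae_closed_def)
  have "L0_open M G (L0 G - D)"
    unfolding L0_open_def
  proof (intro conjI ballI)
    fix X assume X: "X \<in> L0 G - D"
    show "\<exists>\<epsilon>>0. \<forall>Y\<in>L0 G. measure M {\<omega>\<in>space M. norm (Y \<omega> - X \<omega>) > \<epsilon>} < \<epsilon> \<longrightarrow> Y \<in> L0 G - D"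
    proof (rule ccontr)
      assume neg: "\<not> ?thesis"
      have "\<exists>Y\<in>D. measure M {\<omega>\<in>space M. norm (Y \<omega> - X \<omega>) > (1/2)^n} < (1/2)^n" for n :: nat
        using neg by (auto dest!: spec[of _ "(1/2)^n"])
      then have "\<forall>n::nat. \<exists>Y. Y \<in> D \<and> measure M {\<omega>\<in>space M. norm (Y \<omega> - X \<omega>) > (1/2)^n} < (1/2)^n"
        by blast
      from choice[OF this] obtain Y where Y: "\<And>n. Y n \<in> D"
        "\<And>n::nat. measure M {\<omega>\<in>space M. norm (Y n \<omega> - X \<omega>) > (1/2)^n} < (1/2)^n"
        by blast
      have "AE \<omega> in M. (\<lambda>n. Y n \<omega>) \<longlonglongrightarrow> X \<omega>"
        using Y X D L0_borel_measurable[OF sub]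
        by (intro AE_tendsto_fast[OF prob]) (auto simp: subset_iff less_imp_le)
      with X have "X \<in> D" by (intro ae_closedD[OF cl _ Y(1)]) simp
      then show False using X by simp
    qed
  qed simp
  then show "closedin (L0_topology M G) D"
    using D unfolding closedin_def openin_L0_topology[OF prob sub] topspace_L0_topology[OF prob sub]
    by simp
qed

section \<open>Measurable choice of convergent subsequences\<close>

text \<open>A measurable Bolzano-Weierstrass theorem. The subsequence has to depend on the point,
  since no single one need converge everywhere; the substance is that its indices can be chosen
  \<open>G\<close>-measurably.\<close>

lemma ex_measurable_convergent_subsequence:
  fixes f :: "nat \<Rightarrow> 'w \<Rightarrow> 'a::euclidean_space"
  assumes f[measurable]: "\<And>n. f n \<in> borel_measurable G"
    and bdd: "\<And>\<omega>. \<omega> \<in> space G \<Longrightarrow> bounded (range (\<lambda>n. f n \<omega>))"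
  obtains \<tau> where "\<And>k. \<tau> k \<in> measurable G (count_space (UNIV :: nat set))"
    and "\<And>\<omega>. \<omega> \<in> space G \<Longrightarrow> strict_mono (\<lambda>k. \<tau> k \<omega>)"
    and "\<And>\<omega>. \<omega> \<in> space G \<Longrightarrow> convergent (\<lambda>k. f (\<tau> k \<omega>) \<omega>)"
proof -
  obtain Q :: "'a set" where Q: "countable Q" "\<And>U. open U \<Longrightarrow> U \<noteq> {} \<Longrightarrow> \<exists>d\<in>Q. d \<in> U"
    by (rule countable_dense_setE) blast
  then have "Q \<noteq> {}" by blast
  define q where "q = from_nat_into Q"
  have q: "\<exists>j. dist x (q j) < e" if "e > 0" for x e
  proof -
    have "ball x e \<noteq> {}" using that by simp
    then obtain d where "d \<in> Q" "d \<in> ball x e"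
      using Q(2)[OF open_ball] by blast
    then show ?thesis
      using from_nat_into_surj[OF Q(1) \<open>d \<in> Q\<close>] by (auto simp: q_def)
  qed
  \<comment> \<open>\<open>R k n \<omega>\<close>: the index \<open>n\<close> survives \<open>k\<close> refinements, the \<open>k\<close>-th of which keeps the points within
    \<open>1/k\<close> of the first \<open>q j\<close> that leaves infinitely many indices. Choosing the first such \<open>j\<close> makes
    the construction measurable.\<close>
  define R where "R = rec_nat (\<lambda>n \<omega>. True) (\<lambda>k R n \<omega>. R n \<omega> \<and>
    dist (f n \<omega>) (q (LEAST j. \<forall>m. \<exists>n>m. R n \<omega> \<and> dist (f n \<omega>) (q j) < 1 / Suc k)) < 1 / Suc k)"
  define J where "J k \<omega> = (LEAST j. \<forall>m. \<exists>n>m. R k n \<omega> \<and> dist (f n \<omega>) (q j) < 1 / Suc k)" for k \<omega>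
  have R0: "R 0 n \<omega>" for n \<omega> by (simp add: R_def)
  have RS: "R (Suc k) n \<omega> \<longleftrightarrow> R k n \<omega> \<and> dist (f n \<omega>) (q (J k \<omega>)) < 1 / Suc k" for k n \<omega>
    by (simp add: R_def J_def)
  have Rm: "Measurable.pred G (R k n)" for k n
  proof (induction k arbitrary: n)
    case 0
    have "R 0 n = (\<lambda>_. True)" using R0 by blast
    then show ?case by simp
  next
    case (Suc k)
    note [measurable] = Suc
    have [measurable]: "J k \<in> measurable G (count_space UNIV)"
      unfolding J_def by measurable
    \<comment> \<open>Splitting over the countably many values of \<open>J k\<close> leaves a fixed
      centre \<open>q j\<close> in each piece.\<close>
    have "Measurable.pred G (\<lambda>\<omega>. \<exists>j. J k \<omega> = j \<and> R k n \<omega> \<and> dist (f n \<omega>) (q j) < 1 / Suc k)"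
      by measurable
    then show ?case by (simp add: RS[abs_def])
  qed
  \<comment> \<open>Infinitely many indices survive each refinement: the surviving points are
    bounded and so accumulate at some \<open>l\<close>, and a dense point \<open>q j\<close> close
    to \<open>l\<close> captures infinitely many of them. This also makes the \<open>LEAST\<close>
    in \<open>J\<close> well defined.\<close>
  have inf: "\<forall>m. \<exists>n>m. R k n \<omega>" if \<omega>: "\<omega> \<in> space G" for k \<omega>
  proof (induction k)
    case 0
    show ?case using R0 by blast
  next
    case (Suc k)
    then have S: "infinite {n. R k n \<omega>}"
      by (auto simp: infinite_nat_iff_unbounded)
    define e where "e = enumerate {n. R k n \<omega>}"
    have e: "strict_mono e" "\<And>n. R k (e n) \<omega>"
      using strict_mono_enumerate[OF S] enumerate_in_set[OF S] by (auto simp: e_def)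
    have "bounded (range (\<lambda>n. f (e n) \<omega>))"
      by (rule bounded_subset[OF bdd[OF \<omega>]]) auto
    then obtain l r where r: "strict_mono r" "(\<lambda>n. f (e (r n)) \<omega>) \<longlonglongrightarrow> l"
      using bounded_imp_convergent_subsequence[of "\<lambda>n. f (e n) \<omega>"] by (auto simp: o_def)
    obtain j where j: "dist l (q j) < 1 / Suc k" using q[of "1 / Suc k" l] by auto
    have "(\<lambda>n. dist (f (e (r n)) \<omega>) (q j)) \<longlonglongrightarrow> dist l (q j)"
      by (intro tendsto_intros r)
    then have "eventually (\<lambda>n. dist (f (e (r n)) \<omega>) (q j) < 1 / Suc k) sequentially"
      using j by (rule order_tendstoD)
    then obtain N where N: "\<And>n. n \<ge> N \<Longrightarrow> dist (f (e (r n)) \<omega>) (q j) < 1 / Suc k"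
      by (auto simp: eventually_sequentially)
    have "\<forall>m. \<exists>n>m. R k n \<omega> \<and> dist (f n \<omega>) (q j) < 1 / Suc k"
    proof
      fix m
      have "strict_mono (e \<circ> r)" using e(1) r(1) by (rule strict_mono_o)
      then have "max N (Suc m) \<le> e (r (max N (Suc m)))"
        using seq_suble[of "e \<circ> r"] by (simp add: o_def)
      then show "\<exists>n>m. R k n \<omega> \<and> dist (f n \<omega>) (q j) < 1 / Suc k"
        using e(2) N[of "max N (Suc m)"] by (intro exI[of _ "e (r (max N (Suc m)))"]) auto
    qed
    then have "\<forall>m. \<exists>n>m. R k n \<omega> \<and> dist (f n \<omega>) (q (J k \<omega>)) < 1 / Suc k"
      unfolding J_def by (rule LeastI)
    then show ?case by (simp add: RS)
  qed
  \<comment> \<open>The start value 0 is admissible because \<open>R 0\<close> holds for every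
    index. Afterwards the strict inequality gives monotonicity, and \<open>R (Suc k)\<close> places
    the chosen point in the first \<open>Suc k\<close> balls.\<close>
  define \<tau> where "\<tau> = rec_nat (\<lambda>\<omega>. 0) (\<lambda>k t \<omega>. LEAST n. n > t \<omega> \<and> R (Suc k) n \<omega>)"
  have \<tau>0: "\<tau> 0 = (\<lambda>\<omega>. 0)" and \<tau>S: "\<tau> (Suc k) = (\<lambda>\<omega>. LEAST n. n > \<tau> k \<omega> \<and> R (Suc k) n \<omega>)" for k
    by (simp_all add: \<tau>_def)
  have \<tau>m: "\<tau> k \<in> measurable G (count_space UNIV)" for k
  proof (induction k)
    case 0
    show ?case by (simp add: \<tau>0)
  next
    case (Suc k)
    note [measurable] = Suc Rm
    show ?case unfolding \<tau>S by measurable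
  qed
  have step: "\<tau> k \<omega> < \<tau> (Suc k) \<omega> \<and> R (Suc k) (\<tau> (Suc k) \<omega>) \<omega>" if "\<omega> \<in> space G" for k \<omega>
  proof -
    have "\<exists>n. n > \<tau> k \<omega> \<and> R (Suc k) n \<omega>" using inf[OF that] by blast
    from LeastI_ex[OF this] show ?thesis by (simp add: \<tau>S)
  qed
  show thesis
  proof (rule that[of \<tau>])
    show "\<tau> k \<in> measurable G (count_space UNIV)" for k by (rule \<tau>m)
    fix \<omega> assume \<omega>: "\<omega> \<in> space G"
    show "strict_mono (\<lambda>k. \<tau> k \<omega>)"
      using step[OF \<omega>] by (simp add: strict_mono_Suc_iff)
    have Rmono: "R l n \<omega> \<Longrightarrow> k \<le> l \<Longrightarrow> R k n \<omega>" for k l n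
      by (induction l) (auto simp: RS le_Suc_eq)
    have R\<tau>: "R k (\<tau> k \<omega>) \<omega>" for k
      by (cases k) (use R0 step[OF \<omega>] in auto)
    \<comment> \<open>All indices after the \<open>k\<close>-th have survived refinement
      \<open>Suc k\<close>, so their points share one ball of radius \<open>1 / Suc k\<close>; this
      is the Cauchy property.\<close>
    have close: "dist (f (\<tau> m \<omega>) \<omega>) (q (J k \<omega>)) < 1 / Suc k" if "m > k" for m k
      using Rmono[OF R\<tau>[of m], of "Suc k"] that by (simp add: RS)
    have "Cauchy (\<lambda>k. f (\<tau> k \<omega>) \<omega>)"
    proof (rule metric_CauchyI)
      fix e :: real assume "e > 0"
      then obtain k where k: "1 / Suc k < e / 2"
        using nat_approx_posE[of "e/2"] by auto
      have "dist (f (\<tau> m \<omega>) \<omega>) (f (\<tau> n \<omega>) \<omega>) < e" if "m > k" "n > k" for m n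
        using close[OF that(1)] close[OF that(2)] k
          dist_triangle2[of "f (\<tau> m \<omega>) \<omega>" "f (\<tau> n \<omega>) \<omega>" "q (J k \<omega>)"] by linarith
      then show "\<exists>M. \<forall>m\<ge>M. \<forall>n\<ge>M. dist (f (\<tau> m \<omega>) \<omega>) (f (\<tau> n \<omega>) \<omega>) < e"
        by (intro exI[of _ "Suc k"]) auto
    qed
    then show "convergent (\<lambda>k. f (\<tau> k \<omega>) \<omega>)" by (rule Cauchy_convergent)
  qed
qed

section \<open>Convex cones stable under bounded measurable multipliers\<close>

text \<open>The multipliers are measurable for \<open>G\<close>, while the elements of
  \<open>D\<close> may be measurable only for a larger algebra \<open>H\<close>: later sums of
  claims are scaled by information available at an earlier time.\<close>

definition stable_cone :: "'w measure \<Rightarrow> ('w \<Rightarrow> real^'d) set \<Rightarrow> bool" where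
  "stable_cone G D \<longleftrightarrow> (\<lambda>_. 0) \<in> D \<and> (\<forall>X\<in>D. \<forall>Y\<in>D. (\<lambda>\<omega>. X \<omega> + Y \<omega>) \<in> D) \<and>
     (\<forall>c\<in>bounded_nonneg G. \<forall>X\<in>D. (\<lambda>\<omega>. c \<omega> *\<^sub>R X \<omega>) \<in> D)"

lemma stable_cone_zero: "stable_cone G D \<Longrightarrow> (\<lambda>_. 0) \<in> D"
  and stable_cone_add: "stable_cone G D \<Longrightarrow> X \<in> D \<Longrightarrow> Y \<in> D \<Longrightarrow> (\<lambda>\<omega>. X \<omega> + Y \<omega>) \<in> D"
  and stable_cone_scale_bounded:
    "stable_cone G D \<Longrightarrow> c \<in> bounded_nonneg G \<Longrightarrow> X \<in> D \<Longrightarrow> (\<lambda>\<omega>. c \<omega> *\<^sub>R X \<omega>) \<in> D"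
  by (auto simp: stable_cone_def)

lemma stable_cone_sum:
  assumes "stable_cone G D" "\<And>i. i \<in> I \<Longrightarrow> X i \<in> D"
  shows "(\<lambda>\<omega>. \<Sum>i\<in>I. X i \<omega>) \<in> D"
  using assms(2)
  by (induction I rule: infinite_finite_induct)
    (auto intro: stable_cone_zero[OF assms(1)] stable_cone_add[OF assms(1)])

text \<open>Truncating \<open>c\<close> at \<open>n\<close> gives bounded multipliers, and at each
  point the truncation is inactive for large \<open>n\<close>, so closedness yields the unbounded
  case.\<close>

lemma stable_cone_scale:
  assumes cl: "ae_closed M H D" and st: "stable_cone G D" and sub: "subalgebra H G"
    and c: "c \<in> borel_measurable G" "\<And>\<omega>. \<omega> \<in> space G \<Longrightarrow> 0 \<le> c \<omega>" and X: "X \<in> D"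
  shows "(\<lambda>\<omega>. c \<omega> *\<^sub>R X \<omega>) \<in> D"
proof (rule ae_closedD[OF cl])
  have [measurable]: "c \<in> borel_measurable H"
    using sub c(1) by (rule measurable_from_subalg)
  have [measurable]: "X \<in> borel_measurable H"
    using cl X by (auto simp: ae_closed_def L0_def)
  show "(\<lambda>\<omega>. c \<omega> *\<^sub>R X \<omega>) \<in> L0 H" unfolding L0_def by measurable
  show "(\<lambda>\<omega>. min (c \<omega>) (real n) *\<^sub>R X \<omega>) \<in> D" for n
    using c by (intro stable_cone_scale_bounded[OF st _ X])
      (auto simp: bounded_nonneg_def intro!: exI[of _ "real n"])
  have "(\<lambda>n. min (c \<omega>) (real n) *\<^sub>R X \<omega>) \<longlonglongrightarrow> c \<omega> *\<^sub>R X \<omega>" for \<omega>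
  proof (rule tendsto_eventually)
    show "eventually (\<lambda>n. min (c \<omega>) (real n) *\<^sub>R X \<omega> = c \<omega> *\<^sub>R X \<omega>) sequentially"
      using eventually_ge_at_top[of "nat \<lceil>c \<omega>\<rceil>"]
      by eventually_elim (auto simp: min_def)
  qed
  then show "AE \<omega> in M. (\<lambda>n. min (c \<omega>) (real n) *\<^sub>R X \<omega>) \<longlonglongrightarrow> c \<omega> *\<^sub>R X \<omega>" by simp
qed

text \<open>The positive part of \<open>c\<close> acts on \<open>X\<close> and the negative part on
  \<open>- X\<close>.\<close>

lemma stable_cone_scale_signed:
  assumes cl: "ae_closed M H D" and st: "stable_cone G D" and sub: "subalgebra H G"
    and c: "c \<in> borel_measurable G" and X: "X \<in> D" "(\<lambda>\<omega>. - X \<omega>) \<in> D"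
  shows "(\<lambda>\<omega>. c \<omega> *\<^sub>R X \<omega>) \<in> D"
proof -
  have "(\<lambda>\<omega>. max (c \<omega>) 0 *\<^sub>R X \<omega> + max (- c \<omega>) 0 *\<^sub>R (- X \<omega>)) \<in> D"
    using c X by (intro stable_cone_add[OF st] stable_cone_scale[OF cl st sub]) auto
  moreover have "max (c \<omega>) 0 *\<^sub>R X \<omega> + max (- c \<omega>) 0 *\<^sub>R (- X \<omega>) = c \<omega> *\<^sub>R X \<omega>" for \<omega>
    by (auto simp: max_def)
  ultimately show ?thesis by simp
qed

text \<open>The events \<open>\<tau> = k\<close> partition the space. Pasting finitely many
  \<open>X k\<close> along them stays in the cone, and at each point these finite sums are
  eventually equal to the glued variable.\<close>

lemma stable_cone_glue:
  assumes cl: "ae_closed M H D" and st: "stable_cone G D" and sub: "subalgebra H G"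
    and \<tau>: "\<tau> \<in> measurable G (count_space (UNIV :: nat set))" and X: "\<And>n. X n \<in> D"
  shows "(\<lambda>\<omega>. X (\<tau> \<omega>) \<omega>) \<in> D"
proof (rule ae_closedD[OF cl])
  note [measurable] = \<tau>
  have [measurable]: "\<tau> \<in> measurable H (count_space UNIV)"
    using sub \<tau> by (rule measurable_from_subalg)
  have [measurable]: "X n \<in> borel_measurable H" for n
    using cl X by (auto simp: ae_closed_def L0_def)
  show "(\<lambda>\<omega>. X (\<tau> \<omega>) \<omega>) \<in> L0 H" unfolding L0_def by measurable
  let ?Y = "\<lambda>n \<omega>. \<Sum>k<n. (if \<tau> \<omega> = k then 1 else 0) *\<^sub>R X k \<omega>"
  show "?Y n \<in> D" for n
  proof (intro stable_cone_sum[OF st] stable_cone_scale_bounded[OF st] X)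
    show "(\<lambda>\<omega>. if \<tau> \<omega> = k then 1 else 0) \<in> bounded_nonneg G" for k
      unfolding bounded_nonneg_def by (auto intro!: exI[of _ 1])
  qed
  have "(\<lambda>n. ?Y n \<omega>) \<longlonglongrightarrow> X (\<tau> \<omega>) \<omega>" for \<omega>
  proof (rule tendsto_eventually)
    show "eventually (\<lambda>n. ?Y n \<omega> = X (\<tau> \<omega>) \<omega>) sequentially"
      using eventually_gt_at_top[of "\<tau> \<omega>"]
      by eventually_elim (simp add: if_distrib[of "\<lambda>x. x *\<^sub>R _"] cong: if_cong)
  qed
  then show "AE \<omega> in M. (\<lambda>n. ?Y n \<omega>) \<longlonglongrightarrow> X (\<tau> \<omega>) \<omega>" by simp
qed

section \<open>Closedness of a sum of two cones by eliminating null directions\<close>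

text \<open>The projected points stay in the old span but are orthogonal to \<open>g\<close>, so
  their span misses the nonzero vector \<open>g\<close>, which the old span contains.\<close>

lemma dim_range_minus_projection_less:
  fixes x :: "nat \<Rightarrow> 'a::euclidean_space"
  assumes g: "g \<in> span (range x)" "norm g = 1"
  shows "dim (range (\<lambda>n. x n - (x n \<bullet> g) *\<^sub>R g)) < dim (range x)"
proof (rule dim_psubset)
  let ?S = "range (\<lambda>n. x n - (x n \<bullet> g) *\<^sub>R g)"
  have "?S \<subseteq> span (range x)"
    using g by (blast intro: span_diff span_scale span_base)
  then have "span ?S \<subseteq> span (range x)"
    by (metis span_mono span_span)
  moreover have "g \<notin> span ?S"
  proof
    assume "g \<in> span ?S"
    have "orthogonal g y" if "y \<in> ?S" for y
      using that g by (auto simp: orthogonal_def inner_diff_right inner_commute norm_eq_1)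
    then have "orthogonal g g"
      using \<open>g \<in> span ?S\<close> orthogonal_to_span by blast
    then show False using g by (auto simp: orthogonal_self)
  qed
  ultimately show "span ?S \<subset> span (range x)" using g by blast
qed

text \<open>The map \<open>x \<mapsto> x / (1 + |x|)\<close> compactifies: it has a limit \<open>p\<close> along a random subsequence, with
  \<open>|p| = 1\<close> exactly where \<open>\<xi>\<close> diverges. There \<open>p\<close> is a null direction, and removing the component
  of \<open>\<xi> n\<close> along \<open>p\<close> lowers the dimension of the span of the sequence.\<close>

lemma limit_in_sum:
  fixes C B :: "('w \<Rightarrow> real^'d) set"
  assumes subM: "subalgebra M H" and sub: "subalgebra H G"
    and C: "ae_closed M G C" "stable_cone G C"
    and B: "ae_closed M H B" "stable_cone G B"
    and null: "\<And>\<xi>. \<xi> \<in> C \<Longrightarrow> (\<lambda>\<omega>. - \<xi> \<omega>) \<in> B \<Longrightarrow> (\<lambda>\<omega>. - \<xi> \<omega>) \<in> C \<and> \<xi> \<in> B"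
    and "X \<in> L0 H" "\<And>n. \<xi> n \<in> C" "\<And>n. \<eta> n \<in> B"
    and "AE \<omega> in M. (\<lambda>n. \<xi> n \<omega> + \<eta> n \<omega>) \<longlonglongrightarrow> X \<omega>"
    and "\<And>\<omega>. \<omega> \<in> space M \<Longrightarrow> dim (range (\<lambda>n. \<xi> n \<omega>)) \<le> k"
  shows "\<exists>\<xi>'\<in>C. \<exists>\<eta>'\<in>B. AE \<omega> in M. X \<omega> = \<xi>' \<omega> + \<eta>' \<omega>"
  using assms(8-)
\<comment> \<open>The induction is on a pointwise bound for the rank of the sequence
  \<open>\<xi>\<close>. The target and both sequences vary, because the step passes to their
  projected versions on the divergence set.\<close>
proof (induction k arbitrary: X \<xi> \<eta>)
  case 0
  have z: "\<xi> n \<omega> = 0" if "\<omega> \<in> space M" for n \<omega>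
    using "0.prems"(5)[OF that] by auto
  have "AE \<omega> in M. (\<lambda>n. \<eta> n \<omega>) \<longlonglongrightarrow> X \<omega>"
    using "0.prems"(4) AE_space by eventually_elim (simp add: z)
  then have "X \<in> B"
    by (rule ae_closedD[OF B(1) "0.prems"(1,3)])
  then show ?case
    using stable_cone_zero[OF C(2)] by (intro bexI[of _ "\<lambda>_. 0"] bexI[of _ X]) auto
next
  case (Suc k)
  note scaleC = stable_cone_scale[OF C(1) C(2)] and scaleB = stable_cone_scale[OF B sub]
  have sp: "space H = space M" "space G = space M"
    using subM sub by (auto simp: subalgebra_def)
  have subG: "subalgebra G G" by (simp add: subalgebra_def)
  have [measurable]: "X \<in> borel_measurable H" using Suc.prems by (simp add: L0_def)
  have [measurable]: "\<xi> n \<in> borel_measurable G" for n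
    using C(1) Suc.prems(2) by (auto simp: ae_closed_def L0_def)
  define a where "a n \<omega> = 1 / (1 + norm (\<xi> n \<omega>))" for n \<omega>
  define \<phi> where "\<phi> n \<omega> = a n \<omega> *\<^sub>R \<xi> n \<omega>" for n \<omega>
  have [measurable]: "a n \<in> borel_measurable G" for n unfolding a_def by measurable
  have [measurable]: "\<phi> n \<in> borel_measurable G" for n unfolding \<phi>_def by measurable
  have a0: "0 \<le> a n \<omega>" for n \<omega> by (simp add: a_def)
  \<comment> \<open>This identity makes \<open>a\<close> converge along the same random subsequence
    as \<open>\<phi>\<close>, with limit \<open>1 - norm (p \<omega>)\<close>.\<close>
  have norm_\<phi>: "norm (\<phi> n \<omega>) = 1 - a n \<omega>" for n \<omega>
  proof -
    have "1 + norm (\<xi> n \<omega>) > 0" using norm_ge_zero[of "\<xi> n \<omega>"] by linarith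
    then show ?thesis by (simp add: \<phi>_def a_def field_simps)
  qed
  have "bounded (range (\<lambda>n. \<phi> n \<omega>))" for \<omega>
    using norm_\<phi>[of _ \<omega>] a0[of _ \<omega>] by (auto simp: bounded_iff intro!: exI[of _ 1])
  then obtain \<tau> where \<tau>: "\<And>k. \<tau> k \<in> measurable G (count_space (UNIV :: nat set))"
      "\<And>\<omega>. \<omega> \<in> space G \<Longrightarrow> strict_mono (\<lambda>k. \<tau> k \<omega>)"
      "\<And>\<omega>. \<omega> \<in> space G \<Longrightarrow> convergent (\<lambda>k. \<phi> (\<tau> k \<omega>) \<omega>)"
    using ex_measurable_convergent_subsequence[of \<phi> G] by auto
  note [measurable] = \<tau>(1)
  define p where "p \<omega> = lim (\<lambda>k. \<phi> (\<tau> k \<omega>) \<omega>)" for \<omega>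
  have p: "(\<lambda>k. \<phi> (\<tau> k \<omega>) \<omega>) \<longlonglongrightarrow> p \<omega>" if "\<omega> \<in> space M" for \<omega>
    using \<tau>(3) that sp by (simp add: p_def convergent_LIMSEQ_iff)
  have pm[measurable]: "p \<in> borel_measurable G"
    by (rule borel_measurable_LIMSEQ_metric[where f = "\<lambda>k \<omega>. \<phi> (\<tau> k \<omega>) \<omega>"])
      (use p sp in auto)
  have [measurable]: "p \<in> borel_measurable H"
    using sub pm by (rule measurable_from_subalg)
  have "\<phi> n \<in> C" for n
    unfolding \<phi>_def using a0 Suc.prems by (intro scaleC subG) auto
  then have "(\<lambda>\<omega>. \<phi> (\<tau> k \<omega>) \<omega>) \<in> C" for k
    by (rule stable_cone_glue[OF C subG \<tau>(1)])
  then have pC: "p \<in> C"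
    by (rule ae_closedD[OF C(1), rotated]) (use p in \<open>auto simp: L0_def intro!: AE_I2\<close>)
  have a_lim: "(\<lambda>k. a (\<tau> k \<omega>) \<omega>) \<longlonglongrightarrow> 1 - norm (p \<omega>)" if "\<omega> \<in> space M" for \<omega>
  proof -
    have "(\<lambda>k. 1 - norm (\<phi> (\<tau> k \<omega>) \<omega>)) \<longlonglongrightarrow> 1 - norm (p \<omega>)"
      by (intro tendsto_intros p that)
    then show ?thesis by (simp add: norm_\<phi>)
  qed
  have p1: "norm (p \<omega>) \<le> 1" if "\<omega> \<in> space M" for \<omega>
    using LIMSEQ_le_const[OF a_lim[OF that], of 0] a0 by simp
  \<comment> \<open>The limit of \<open>a *\<^sub>R \<eta>\<close> along the subsequence: the scaled
    sums tend to \<open>(1 - norm (p \<omega>)) *\<^sub>R X \<omega>\<close>, and their first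
    summand \<open>\<phi>\<close> tends to \<open>p\<close>.\<close>
  define b where "b \<omega> = (1 - norm (p \<omega>)) *\<^sub>R X \<omega> - p \<omega>" for \<omega>
  have "(\<lambda>\<omega>. a n \<omega> *\<^sub>R \<eta> n \<omega>) \<in> B" for n
    using a0 Suc.prems by (intro scaleB) auto
  then have aB: "(\<lambda>\<omega>. a (\<tau> k \<omega>) \<omega> *\<^sub>R \<eta> (\<tau> k \<omega>) \<omega>) \<in> B" for k
    by (rule stable_cone_glue[OF B sub \<tau>(1)])
  have bB: "b \<in> B"
  proof (rule ae_closedD[OF B(1) _ aB])
    show "b \<in> L0 H" unfolding L0_def b_def by measurable
    show "AE \<omega> in M. (\<lambda>k. a (\<tau> k \<omega>) \<omega> *\<^sub>R \<eta> (\<tau> k \<omega>) \<omega>) \<longlonglongrightarrow> b \<omega>"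
      using Suc.prems(4) AE_space
    proof eventually_elim
      fix \<omega> assume lim: "(\<lambda>n. \<xi> n \<omega> + \<eta> n \<omega>) \<longlonglongrightarrow> X \<omega>" and \<omega>: "\<omega> \<in> space M"
      have "(\<lambda>k. \<xi> (\<tau> k \<omega>) \<omega> + \<eta> (\<tau> k \<omega>) \<omega>) \<longlonglongrightarrow> X \<omega>"
        using LIMSEQ_subseq_LIMSEQ[OF lim \<tau>(2)[of \<omega>]] \<omega> sp by (simp add: o_def)
      then have "(\<lambda>k. a (\<tau> k \<omega>) \<omega> *\<^sub>R (\<xi> (\<tau> k \<omega>) \<omega> + \<eta> (\<tau> k \<omega>) \<omega>) - \<phi> (\<tau> k \<omega>) \<omega>) \<longlonglongrightarrow> b \<omega>"
        unfolding b_def by (intro tendsto_intros a_lim p \<omega>)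
      then show "(\<lambda>k. a (\<tau> k \<omega>) \<omega> *\<^sub>R \<eta> (\<tau> k \<omega>) \<omega>) \<longlonglongrightarrow> b \<omega>"
        by (simp add: \<phi>_def scaleR_add_right)
    qed
  qed
  \<comment> \<open>\<open>u\<close> is the indicator of the divergence set
    \<open>norm p = 1\<close>; off this set \<open>v\<close> undoes the factor
    \<open>1 - norm p\<close> in front of \<open>X\<close>.\<close>
  define u :: "'w \<Rightarrow> real" where "u \<omega> = (if norm (p \<omega>) = 1 then 1 else 0)" for \<omega>
  define v where "v \<omega> = (if norm (p \<omega>) = 1 then 0 else 1 / (1 - norm (p \<omega>)))" for \<omega>
  have um: "u \<in> borel_measurable G" "v \<in> borel_measurable G"
    unfolding u_def v_def by measurable
  have u0: "0 \<le> u \<omega>" for \<omega> by (simp add: u_def)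
  have v0: "0 \<le> v \<omega>" if "\<omega> \<in> space M" for \<omega> using p1[OF that] by (simp add: v_def)
  define g where "g \<omega> = u \<omega> *\<^sub>R p \<omega>" for \<omega>
  have gC: "g \<in> C"
    unfolding g_def using u0 um pC by (intro scaleC subG) auto
  have "(\<lambda>\<omega>. u \<omega> *\<^sub>R b \<omega>) \<in> B"
    using u0 um bB by (intro scaleB) auto
  \<comment> \<open>On the divergence set the coefficient of \<open>X\<close> in \<open>b\<close> is
    0, which leaves \<open>- p\<close>.\<close>
  moreover have "(\<lambda>\<omega>. u \<omega> *\<^sub>R b \<omega>) = (\<lambda>\<omega>. - g \<omega>)"
    by (auto simp: g_def b_def u_def)
  ultimately have ngB: "(\<lambda>\<omega>. - g \<omega>) \<in> B" by simp
  then have ngC: "(\<lambda>\<omega>. - g \<omega>) \<in> C" and gB: "g \<in> B"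
    using null[OF gC] by auto
  have [measurable]: "g \<in> borel_measurable G" unfolding g_def using um by measurable
  \<comment> \<open>The coefficient along \<open>g\<close> may have either sign, which is why
    \<open>g\<close> and \<open>- g\<close> are needed in both cones. What is taken from
    \<open>\<xi>\<close> is given to \<open>\<eta>\<close>, so the sum is only multiplied by
    \<open>u\<close>.\<close>
  define \<beta> where "\<beta> n \<omega> = \<xi> n \<omega> \<bullet> g \<omega>" for n \<omega>
  have \<beta>m: "\<beta> n \<in> borel_measurable G" for n unfolding \<beta>_def by measurable
  define \<xi>' where "\<xi>' n \<omega> = u \<omega> *\<^sub>R \<xi> n \<omega> + \<beta> n \<omega> *\<^sub>R (- g \<omega>)" for n \<omega>
  define \<eta>' where "\<eta>' n \<omega> = u \<omega> *\<^sub>R \<eta> n \<omega> + \<beta> n \<omega> *\<^sub>R g \<omega>" for n \<omega>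
  have "\<exists>\<xi>''\<in>C. \<exists>\<eta>''\<in>B. AE \<omega> in M. u \<omega> *\<^sub>R X \<omega> = \<xi>'' \<omega> + \<eta>'' \<omega>"
  proof (rule Suc.IH)
    have "u \<in> borel_measurable H" using sub um(1) by (rule measurable_from_subalg)
    then show "(\<lambda>\<omega>. u \<omega> *\<^sub>R X \<omega>) \<in> L0 H" unfolding L0_def by measurable
    show "\<xi>' n \<in> C" for n
      unfolding \<xi>'_def using u0 um Suc.prems ngC gC \<beta>m
      by (intro stable_cone_add[OF C(2)] scaleC subG stable_cone_scale_signed[OF C subG]) auto
    show "\<eta>' n \<in> B" for n
      unfolding \<eta>'_def using u0 um Suc.prems ngB gB \<beta>m
      by (intro stable_cone_add[OF B(2)] scaleB stable_cone_scale_signed[OF B sub]) auto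
    show "AE \<omega> in M. (\<lambda>n. \<xi>' n \<omega> + \<eta>' n \<omega>) \<longlonglongrightarrow> u \<omega> *\<^sub>R X \<omega>"
      using Suc.prems(4)
    proof eventually_elim
      fix \<omega> assume "(\<lambda>n. \<xi> n \<omega> + \<eta> n \<omega>) \<longlonglongrightarrow> X \<omega>"
      then have "(\<lambda>n. u \<omega> *\<^sub>R (\<xi> n \<omega> + \<eta> n \<omega>)) \<longlonglongrightarrow> u \<omega> *\<^sub>R X \<omega>"
        by (intro tendsto_intros)
      then show "(\<lambda>n. \<xi>' n \<omega> + \<eta>' n \<omega>) \<longlonglongrightarrow> u \<omega> *\<^sub>R X \<omega>"
        by (simp add: \<xi>'_def \<eta>'_def scaleR_add_right)
    qed
    fix \<omega> assume \<omega>: "\<omega> \<in> space M"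
    show "dim (range (\<lambda>n. \<xi>' n \<omega>)) \<le> k"
    proof (cases "norm (p \<omega>) = 1")
      case True
      then have g: "g \<omega> = p \<omega>" "\<xi>' n \<omega> = \<xi> n \<omega> - (\<xi> n \<omega> \<bullet> p \<omega>) *\<^sub>R p \<omega>" for n
        by (simp_all add: g_def u_def \<xi>'_def \<beta>_def)
      \<comment> \<open>Every \<open>\<phi>\<close> is a multiple of some \<open>\<xi> n\<close>,
        and spans in finite dimension are closed.\<close>
      have "p \<omega> \<in> span (range (\<lambda>n. \<xi> n \<omega>))"
      proof (rule closed_sequentially[OF closed_span _ p[OF \<omega>]])
        show "\<phi> (\<tau> k \<omega>) \<omega> \<in> span (range (\<lambda>n. \<xi> n \<omega>))" for k
          by (auto simp: \<phi>_def intro: span_scale[OF span_base])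
      qed
      from dim_range_minus_projection_less[OF this True]
      show ?thesis using Suc.prems(5)[OF \<omega>] by (simp add: g)
    next
      case False
      \<comment> \<open>The factor \<open>u\<close> serves this case: where \<open>\<xi>\<close>
        does not diverge there is no direction to remove, so the sequence is set to zero
        there.\<close>
      then have "range (\<lambda>n. \<xi>' n \<omega>) \<subseteq> {0}"
        by (auto simp: g_def u_def \<xi>'_def)
      then show ?thesis by (metis dim_eq_0 le0)
    qed
  qed
  then obtain \<xi>'' \<eta>'' where *: "\<xi>'' \<in> C" "\<eta>'' \<in> B" "AE \<omega> in M. u \<omega> *\<^sub>R X \<omega> = \<xi>'' \<omega> + \<eta>'' \<omega>"
    by blast
  \<comment> \<open>Since \<open>p + b\<close> equals \<open>(1 - norm p) *\<^sub>R X\<close>,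
    multiplying by \<open>v\<close> recovers \<open>X\<close> off the divergence set; the induction
    hypothesis supplies the part on it.\<close>
  show ?case
  proof (intro bexI)
    show "(\<lambda>\<omega>. v \<omega> *\<^sub>R p \<omega> + \<xi>'' \<omega>) \<in> C"
      using um v0 sp pC * by (intro stable_cone_add[OF C(2)] scaleC subG) auto
    show "(\<lambda>\<omega>. v \<omega> *\<^sub>R b \<omega> + \<eta>'' \<omega>) \<in> B"
      using um v0 sp bB * by (intro stable_cone_add[OF B(2)] scaleB) auto
    show "AE \<omega> in M. X \<omega> = v \<omega> *\<^sub>R p \<omega> + \<xi>'' \<omega> + (v \<omega> *\<^sub>R b \<omega> + \<eta>'' \<omega>)"
      using *(3)
    proof eventually_elim
      fix \<omega> assume u: "u \<omega> *\<^sub>R X \<omega> = \<xi>'' \<omega> + \<eta>'' \<omega>"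
      have "v \<omega> *\<^sub>R p \<omega> + v \<omega> *\<^sub>R b \<omega> = (1 - u \<omega>) *\<^sub>R X \<omega>"
        by (simp add: b_def scaleR_diff_right u_def v_def)
      then have "X \<omega> = (v \<omega> *\<^sub>R p \<omega> + v \<omega> *\<^sub>R b \<omega>) + u \<omega> *\<^sub>R X \<omega>"
        by (simp add: scaleR_diff_left)
      then show "X \<omega> = v \<omega> *\<^sub>R p \<omega> + \<xi>'' \<omega> + (v \<omega> *\<^sub>R b \<omega> + \<eta>'' \<omega>)"
        unfolding u by (simp add: algebra_simps)
    qed
  qed
qed

text \<open>The dimension of the whole space bounds the rank of any sequence, which starts the
  elimination in \<open>limit_in_sum\<close>. The countably many decompositions hold simultaneously
  outside one null set.\<close>

lemma ae_closed_sum: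
  fixes C B :: "('w \<Rightarrow> real^'d) set"
  assumes "subalgebra M H" "subalgebra H G"
    and "ae_closed M G C" "stable_cone G C" "ae_closed M H B" "stable_cone G B"
    and "\<And>\<xi>. \<xi> \<in> C \<Longrightarrow> (\<lambda>\<omega>. - \<xi> \<omega>) \<in> B \<Longrightarrow> (\<lambda>\<omega>. - \<xi> \<omega>) \<in> C \<and> \<xi> \<in> B"
  shows "ae_closed M H {X \<in> L0 H. \<exists>\<xi>\<in>C. \<exists>\<eta>\<in>B. AE \<omega> in M. X \<omega> = \<xi> \<omega> + \<eta> \<omega>}" (is "ae_closed M H ?S")
  unfolding ae_closed_def
proof (intro conjI ballI allI impI)
  fix X Y assume X: "X \<in> L0 H" and Y: "\<forall>n. Y n \<in> ?S"
    and lim: "AE \<omega> in M. (\<lambda>n. Y n \<omega>) \<longlonglongrightarrow> X \<omega>"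
  obtain \<xi> \<eta> where *: "\<And>n. \<xi> n \<in> C" "\<And>n. \<eta> n \<in> B" "\<And>n. AE \<omega> in M. Y n \<omega> = \<xi> n \<omega> + \<eta> n \<omega>"
    using Y by simp metis
  have "AE \<omega> in M. \<forall>n. Y n \<omega> = \<xi> n \<omega> + \<eta> n \<omega>"
    using *(3) by (simp add: AE_all_countable)
  then have "AE \<omega> in M. (\<lambda>n. \<xi> n \<omega> + \<eta> n \<omega>) \<longlonglongrightarrow> X \<omega>"
    using lim by eventually_elim simp
  then have "\<exists>\<xi>'\<in>C. \<exists>\<eta>'\<in>B. AE \<omega> in M. X \<omega> = \<xi>' \<omega> + \<eta>' \<omega>"
    using X * by (intro limit_in_sum[OF assms, where k = "DIM(real^'d)"] dim_subset_UNIV)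
  then show "X \<in> ?S" using X by blast
qed auto

section \<open>Attainable and scalable claims as convex cones\<close>

lemma bounded_nonneg_const: "0 \<le> K \<Longrightarrow> (\<lambda>_. K) \<in> bounded_nonneg G"
  by (auto simp: bounded_nonneg_def)

lemma bounded_nonneg_mult:
  assumes "b \<in> bounded_nonneg G" "c \<in> bounded_nonneg G"
  shows "(\<lambda>\<omega>. b \<omega> * c \<omega>) \<in> bounded_nonneg G"
proof -
  obtain K L where "\<forall>\<omega>\<in>space G. 0 \<le> b \<omega> \<and> b \<omega> \<le> K" "\<forall>\<omega>\<in>space G. 0 \<le> c \<omega> \<and> c \<omega> \<le> L"
    using assms by (auto simp: bounded_nonneg_def)
  then have "\<forall>\<omega>\<in>space G. b \<omega> * c \<omega> \<le> K * L"
    by (meson mult_mono order_trans)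
  then show ?thesis
    using assms by (auto simp: bounded_nonneg_def)
qed

locale trading_model =
  fixes M :: "'w measure" and T :: nat and F :: "nat \<Rightarrow> 'w measure"
    and \<pi> :: "nat \<Rightarrow> 'w \<Rightarrow> real^'d^'d"
  assumes filtration: "finite_filtration M T F"
begin

abbreviation "A \<equiv> attainable M T F \<pi>"
abbreviation "C \<equiv> scalable_claims M T F \<pi>"

lemma subM: "t \<le> T \<Longrightarrow> subalgebra M (F t)"
  using filtration by (simp add: finite_filtration_def)

lemma subF: "s \<le> t \<Longrightarrow> t \<le> T \<Longrightarrow> subalgebra (F t) (F s)"
  using filtration by (simp add: finite_filtration_def)

lemma space_F: "t \<le> T \<Longrightarrow> space (F t) = space M"
  using subM by (simp add: subalgebra_def)

lemma L0_mono: "s \<le> t \<Longrightarrow> t \<le> T \<Longrightarrow> X \<in> L0 (F s) \<Longrightarrow> X \<in> L0 (F t)"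
  unfolding L0_def using subF by (rule measurable_from_subalg)

lemma bounded_nonneg_mono:
  "s \<le> t \<Longrightarrow> t \<le> T \<Longrightarrow> c \<in> bounded_nonneg (F s) \<Longrightarrow> c \<in> bounded_nonneg (F t)"
  using measurable_from_subalg[OF subF] by (auto simp: bounded_nonneg_def space_F)

lemma L0_scale:
  "t \<le> T \<Longrightarrow> c \<in> bounded_nonneg (F t) \<Longrightarrow> X \<in> L0 (F t) \<Longrightarrow> (\<lambda>\<omega>. c \<omega> *\<^sub>R X \<omega>) \<in> L0 (F t)"
  by (auto simp: bounded_nonneg_def L0_def)

lemma stable_cone_trading_cone:
  assumes t: "t \<le> T"
  shows "stable_cone (F t) (trading_cone M F \<pi> t)"
proof -
  let ?K = "\<lambda>\<omega>. uminus ` solvency_cone (\<pi> t \<omega>)"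
  have K: "convex_cone (?K \<omega>)" for \<omega>
    unfolding solvency_cone_def
    by (intro convex_cone_linear_image conjI convex_cone_convex_cone_hull
        bounded_linear.linear[OF bounded_linear_minus] bounded_linear_ident)
  have mem: "X \<in> trading_cone M F \<pi> t \<longleftrightarrow> X \<in> L0 (F t) \<and> (AE \<omega> in M. X \<omega> \<in> ?K \<omega>)" for X
    by (simp add: trading_cone_def L0_selections_def)
  show ?thesis
    unfolding stable_cone_def
  proof (intro conjI ballI)
    show "(\<lambda>_. 0) \<in> trading_cone M F \<pi> t"
      unfolding mem using convex_cone_contains_0[OF K] by (simp add: L0_def)
  next
    fix X Y assume X: "X \<in> trading_cone M F \<pi> t" and Y: "Y \<in> trading_cone M F \<pi> t"
    have "AE \<omega> in M. X \<omega> \<in> ?K \<omega>" "AE \<omega> in M. Y \<omega> \<in> ?K \<omega>"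
      using X Y unfolding mem by auto
    then have "AE \<omega> in M. X \<omega> + Y \<omega> \<in> ?K \<omega>"
      by eventually_elim (rule convex_cone_add[OF K])
    then show "(\<lambda>\<omega>. X \<omega> + Y \<omega>) \<in> trading_cone M F \<pi> t"
      using X Y unfolding mem by (auto simp: L0_def)
  next
    fix c X assume c: "c \<in> bounded_nonneg (F t)" and X: "X \<in> trading_cone M F \<pi> t"
    have "AE \<omega> in M. X \<omega> \<in> ?K \<omega>" "AE \<omega> in M. 0 \<le> c \<omega>"
      using X c space_F[OF t] unfolding mem by (auto simp: bounded_nonneg_def)
    then have "AE \<omega> in M. c \<omega> *\<^sub>R X \<omega> \<in> ?K \<omega>"
      by eventually_elim (rule convex_cone_scaleR[OF K])
    then show "(\<lambda>\<omega>. c \<omega> *\<^sub>R X \<omega>) \<in> trading_cone M F \<pi> t"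
      using X L0_scale[OF t c, of X] unfolding mem by blast
  qed
qed

lemma attainable_iff: "X \<in> A \<longleftrightarrow> X \<in> L0 (F T) \<and> (\<exists>\<xi>. (\<forall>t\<le>T. \<xi> t \<in> trading_cone M F \<pi> t) \<and>
    (AE \<omega> in M. X \<omega> = (\<Sum>t\<le>T. \<xi> t \<omega>)))"
  by (simp add: attainable_def)

lemma scalable_claims_iff:
  "X \<in> C t \<longleftrightarrow> X \<in> L0 (F t) \<and> (\<forall>c\<in>bounded_nonneg (F t). (\<lambda>\<omega>. c \<omega> *\<^sub>R X \<omega>) \<in> A)"
  by (simp add: scalable_claims_def)

lemma attainable_AE_eq:
  assumes X: "X \<in> A" and Y: "Y \<in> L0 (F T)" and eq: "AE \<omega> in M. Y \<omega> = X \<omega>"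
  shows "Y \<in> A"
proof -
  obtain \<xi> where \<xi>: "\<forall>t\<le>T. \<xi> t \<in> trading_cone M F \<pi> t" "AE \<omega> in M. X \<omega> = (\<Sum>t\<le>T. \<xi> t \<omega>)"
    using X unfolding attainable_iff by blast
  have "AE \<omega> in M. Y \<omega> = (\<Sum>t\<le>T. \<xi> t \<omega>)"
    using eq \<xi>(2) by eventually_elim simp
  then show ?thesis
    using Y \<xi>(1) unfolding attainable_iff by blast
qed

lemma attainable_add:
  assumes X: "X \<in> A" and Y: "Y \<in> A"
  shows "(\<lambda>\<omega>. X \<omega> + Y \<omega>) \<in> A"
proof -
  obtain \<xi> where \<xi>: "\<And>t. t \<le> T \<Longrightarrow> \<xi> t \<in> trading_cone M F \<pi> t" "AE \<omega> in M. X \<omega> = (\<Sum>t\<le>T. \<xi> t \<omega>)"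
    using X unfolding attainable_iff by blast
  obtain \<eta> where \<eta>: "\<And>t. t \<le> T \<Longrightarrow> \<eta> t \<in> trading_cone M F \<pi> t" "AE \<omega> in M. Y \<omega> = (\<Sum>t\<le>T. \<eta> t \<omega>)"
    using Y unfolding attainable_iff by blast
  have "AE \<omega> in M. X \<omega> + Y \<omega> = (\<Sum>t\<le>T. \<xi> t \<omega> + \<eta> t \<omega>)"
    using \<xi>(2) \<eta>(2) by eventually_elim (simp add: sum.distrib)
  moreover have "(\<lambda>\<omega>. \<xi> t \<omega> + \<eta> t \<omega>) \<in> trading_cone M F \<pi> t" if "t \<le> T" for t
    using stable_cone_add[OF stable_cone_trading_cone \<xi>(1) \<eta>(1)] that by blast
  ultimately show ?thesis
    using X Y unfolding attainable_iff
    by (intro conjI exI[of _ "\<lambda>t \<omega>. \<xi> t \<omega> + \<eta> t \<omega>"]) (auto simp: L0_def)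
qed

lemma trading_cone_subset_attainable:
  assumes t: "t \<le> T" and X: "X \<in> trading_cone M F \<pi> t"
  shows "X \<in> A"
  unfolding attainable_iff
proof (intro conjI exI allI impI)
  show "X \<in> L0 (F T)"
    using X by (intro L0_mono[OF t]) (auto simp: trading_cone_def L0_selections_def)
  show "(if s = t then X else (\<lambda>_. 0)) \<in> trading_cone M F \<pi> s" if "s \<le> T" for s
    using X stable_cone_zero[OF stable_cone_trading_cone[OF that]] by simp
  show "AE \<omega> in M. X \<omega> = (\<Sum>s\<le>T. (if s = t then X else (\<lambda>_. 0)) \<omega>)"
    using t by (simp add: if_distrib[of "\<lambda>f. f _"] cong: if_cong)
qed

lemma attainable_zero: "(\<lambda>_. 0) \<in> A"
  using stable_cone_zero[OF stable_cone_trading_cone] trading_cone_subset_attainable by blast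

lemma attainable_sum: "(\<And>i. i \<in> I \<Longrightarrow> X i \<in> A) \<Longrightarrow> (\<lambda>\<omega>. \<Sum>i\<in>I. X i \<omega>) \<in> A"
  by (induction I rule: infinite_finite_induct) (auto intro: attainable_zero attainable_add)

lemma scalable_claims_subset_attainable: "X \<in> C t \<Longrightarrow> X \<in> A"
  using bounded_nonneg_const[of 1] unfolding scalable_claims_iff by fastforce

lemma trading_cone_subset_scalable_claims:
  assumes t: "t \<le> T" and X: "X \<in> trading_cone M F \<pi> t"
  shows "X \<in> C t"
  unfolding scalable_claims_iff
proof (intro conjI ballI)
  show "X \<in> L0 (F t)" using X by (simp add: trading_cone_def L0_selections_def)
  show "(\<lambda>\<omega>. c \<omega> *\<^sub>R X \<omega>) \<in> A" if "c \<in> bounded_nonneg (F t)" for c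
    using t stable_cone_scale_bounded[OF stable_cone_trading_cone[OF t] that X]
    by (rule trading_cone_subset_attainable)
qed

lemma stable_cone_scalable_claims:
  assumes t: "t \<le> T"
  shows "stable_cone (F t) (C t)"
  unfolding stable_cone_def
proof (intro conjI ballI)
  show "(\<lambda>_. 0) \<in> C t"
    using attainable_zero by (simp add: scalable_claims_iff L0_def)
  show "(\<lambda>\<omega>. X \<omega> + Y \<omega>) \<in> C t" if "X \<in> C t" "Y \<in> C t" for X Y
    using that attainable_add by (auto simp: scalable_claims_iff L0_def scaleR_add_right)
  show "(\<lambda>\<omega>. b \<omega> *\<^sub>R X \<omega>) \<in> C t" if "b \<in> bounded_nonneg (F t)" "X \<in> C t" for b X
    using that bounded_nonneg_mult[OF _ that(1)] L0_scale[OF t]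
    by (auto simp: scalable_claims_iff)
qed

section \<open>Tails: sums of scalable claims from a given time on\<close>

text \<open>The summands come from the cones \<open>C s\<close> and not from the trading cones,
  because closedness is assumed for the former.\<close>

definition tail :: "nat \<Rightarrow> ('w \<Rightarrow> real^'d) set" where
  "tail t = {X \<in> L0 (F T). \<exists>\<xi>. (\<forall>s\<in>{t..T}. \<xi> s \<in> C s) \<and> (AE \<omega> in M. X \<omega> = (\<Sum>s=t..T. \<xi> s \<omega>))}"

lemma tail_subset_attainable: "X \<in> tail t \<Longrightarrow> X \<in> A"
  unfolding tail_def
  by (auto intro: attainable_AE_eq[OF attainable_sum] scalable_claims_subset_attainable)

text \<open>Trading cones lie in the cones \<open>C t\<close>, which lie in \<open>A\<close>, and
  \<open>A\<close> is closed under sums; enlarging the summands therefore adds no claim.\<close>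

lemma tail_zero: "tail 0 = A"
proof
  show "tail 0 \<subseteq> A" using tail_subset_attainable by blast
  show "A \<subseteq> tail 0"
  proof
    fix X assume X: "X \<in> A"
    then obtain \<xi> where \<xi>: "\<forall>t\<le>T. \<xi> t \<in> trading_cone M F \<pi> t" "AE \<omega> in M. X \<omega> = (\<Sum>t\<le>T. \<xi> t \<omega>)"
      unfolding attainable_iff by blast
    then have "\<forall>s\<in>{0..T}. \<xi> s \<in> C s" "AE \<omega> in M. X \<omega> = (\<Sum>s=0..T. \<xi> s \<omega>)"
      using trading_cone_subset_scalable_claims by (auto simp: atMost_atLeast0)
    then show "X \<in> tail 0"
      using X unfolding tail_def attainable_iff by blast
  qed
qed

lemma scalable_claims_subset_tail:
  assumes "t \<le> T" "X \<in> C t"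
  shows "X \<in> tail t"
  unfolding tail_def
proof (intro CollectI conjI exI ballI)
  show "X \<in> L0 (F T)"
    using assms by (intro L0_mono[OF assms(1)]) (auto simp: scalable_claims_iff)
  show "(if s = t then X else (\<lambda>_. 0)) \<in> C s" if "s \<in> {t..T}" for s
    using assms stable_cone_zero[OF stable_cone_scalable_claims] that by simp
  show "AE \<omega> in M. X \<omega> = (\<Sum>s=t..T. (if s = t then X else (\<lambda>_. 0)) \<omega>)"
    using assms by (simp add: if_distrib[of "\<lambda>f. f _"] cong: if_cong)
qed

text \<open>A multiplier known at time \<open>s\<close> is known at every time of the tail, so it
  can be applied to each summand.\<close>

lemma stable_cone_tail:
  assumes "s \<le> t" "t \<le> T"
  shows "stable_cone (F s) (tail t)"
  unfolding stable_cone_def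
proof (intro conjI ballI)
  note C = stable_cone_scalable_claims
  show "(\<lambda>_. 0) \<in> tail t"
    using assms by (intro scalable_claims_subset_tail stable_cone_zero[OF C])
next
  fix X Y assume X: "X \<in> tail t" and Y: "Y \<in> tail t"
  note C = stable_cone_scalable_claims
  obtain \<xi> where \<xi>: "\<And>s. s \<in> {t..T} \<Longrightarrow> \<xi> s \<in> C s" "AE \<omega> in M. X \<omega> = (\<Sum>s=t..T. \<xi> s \<omega>)"
    using X unfolding tail_def by blast
  obtain \<eta> where \<eta>: "\<And>s. s \<in> {t..T} \<Longrightarrow> \<eta> s \<in> C s" "AE \<omega> in M. Y \<omega> = (\<Sum>s=t..T. \<eta> s \<omega>)"
    using Y unfolding tail_def by blast
  have "AE \<omega> in M. X \<omega> + Y \<omega> = (\<Sum>s=t..T. \<xi> s \<omega> + \<eta> s \<omega>)"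
    using \<xi>(2) \<eta>(2) by eventually_elim (simp add: sum.distrib)
  moreover have "(\<lambda>\<omega>. \<xi> s \<omega> + \<eta> s \<omega>) \<in> C s" if "s \<in> {t..T}" for s
    using stable_cone_add[OF C \<xi>(1) \<eta>(1)] that by simp
  ultimately show "(\<lambda>\<omega>. X \<omega> + Y \<omega>) \<in> tail t"
    using X Y unfolding tail_def
    by (intro CollectI conjI exI[of _ "\<lambda>s \<omega>. \<xi> s \<omega> + \<eta> s \<omega>"]) (auto simp: L0_def)
next
  fix c X assume c: "c \<in> bounded_nonneg (F s)" and X: "X \<in> tail t"
  note C = stable_cone_scalable_claims
  obtain \<xi> where \<xi>: "\<And>s. s \<in> {t..T} \<Longrightarrow> \<xi> s \<in> C s" "AE \<omega> in M. X \<omega> = (\<Sum>s=t..T. \<xi> s \<omega>)"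
    using X unfolding tail_def by blast
  have cF: "c \<in> bounded_nonneg (F r)" if "r \<in> {t..T}" for r
    using that assms by (intro bounded_nonneg_mono[OF _ _ c]) auto
  have "AE \<omega> in M. c \<omega> *\<^sub>R X \<omega> = (\<Sum>s=t..T. c \<omega> *\<^sub>R \<xi> s \<omega>)"
    using \<xi>(2) by eventually_elim (simp add: scaleR_sum_right)
  moreover have "(\<lambda>\<omega>. c \<omega> *\<^sub>R \<xi> r \<omega>) \<in> C r" if "r \<in> {t..T}" for r
    using stable_cone_scale_bounded[OF C cF \<xi>(1)] that by simp
  moreover have "(\<lambda>\<omega>. c \<omega> *\<^sub>R X \<omega>) \<in> L0 (F T)"
    using X assms cF[of T] by (intro L0_scale) (auto simp: tail_def)
  ultimately show "(\<lambda>\<omega>. c \<omega> *\<^sub>R X \<omega>) \<in> tail t"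
    unfolding tail_def
    by (intro CollectI conjI exI[of _ "\<lambda>s \<omega>. c \<omega> *\<^sub>R \<xi> s \<omega>"]) auto
qed

text \<open>Splits off the earliest summand, in the form to which \<open>ae_closed_sum\<close>
  applies.\<close>

lemma tail_Suc:
  assumes t: "t < T"
  shows "tail t = {X \<in> L0 (F T). \<exists>\<xi>\<in>C t. \<exists>\<eta>\<in>tail (Suc t). AE \<omega> in M. X \<omega> = \<xi> \<omega> + \<eta> \<omega>}"
    (is "_ = ?S")
proof
  have split: "(\<Sum>s=t..T. f s) = f t + (\<Sum>s=Suc t..T. f s)" for f :: "nat \<Rightarrow> real^'d"
    using t by (intro sum.atLeast_Suc_atMost) simp
  show "tail t \<subseteq> ?S"
  proof
    fix X assume X: "X \<in> tail t"
    obtain \<xi> where \<xi>: "\<And>s. s \<in> {t..T} \<Longrightarrow> \<xi> s \<in> C s" "AE \<omega> in M. X \<omega> = (\<Sum>s=t..T. \<xi> s \<omega>)"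
      using X unfolding tail_def by blast
    have "(\<lambda>\<omega>. \<Sum>s=Suc t..T. \<xi> s \<omega>) \<in> tail (Suc t)"
      unfolding tail_def
    proof (intro CollectI conjI exI[of _ \<xi>] ballI)
      have "\<xi> s \<in> L0 (F T)" if "s \<in> {Suc t..T}" for s
        using \<xi>(1)[of s] that by (intro L0_mono[of s T]) (auto simp: scalable_claims_iff)
      then show "(\<lambda>\<omega>. \<Sum>s=Suc t..T. \<xi> s \<omega>) \<in> L0 (F T)"
        unfolding L0_def by (rule borel_measurable_sum)
    qed (use \<xi> in auto)
    then show "X \<in> ?S"
      using X \<xi>(1)[of t] \<xi>(2) t by (auto simp: split tail_def)
  qed
  show "?S \<subseteq> tail t"
  proof
    fix X assume "X \<in> ?S"
    then obtain \<zeta> \<eta> where X: "X \<in> L0 (F T)" and \<zeta>: "\<zeta> \<in> C t" and \<eta>: "\<eta> \<in> tail (Suc t)"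
      and eq: "AE \<omega> in M. X \<omega> = \<zeta> \<omega> + \<eta> \<omega>" by blast
    obtain \<xi> where \<xi>: "\<And>s. s \<in> {Suc t..T} \<Longrightarrow> \<xi> s \<in> C s" "AE \<omega> in M. \<eta> \<omega> = (\<Sum>s=Suc t..T. \<xi> s \<omega>)"
      using \<eta> unfolding tail_def by blast
    have "AE \<omega> in M. X \<omega> = (\<Sum>s=t..T. (\<xi>(t := \<zeta>)) s \<omega>)"
      using eq \<xi>(2) by eventually_elim (simp add: split)
    moreover have "(\<xi>(t := \<zeta>)) s \<in> C s" if "s \<in> {t..T}" for s
      using \<zeta> \<xi>(1)[of s] that by auto
    ultimately show "X \<in> tail t"
      using X unfolding tail_def by blast
  qed
qed

section \<open>Reversible null claims and backward induction\<close>

text \<open>The later tail is stable under multipliers known at time \<open>t\<close> and at time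
  \<open>Suc t\<close>. The first kind gives \<open>- \<xi>\<close> in \<open>C t\<close>; the
  second, together with constant multiples of \<open>\<xi>\<close>, gives \<open>\<xi>\<close> in
  \<open>C (Suc t)\<close>.\<close>

lemma null_claim_reversible:
  assumes t: "t < T" and \<xi>: "\<xi> \<in> C t" and neg: "(\<lambda>\<omega>. - \<xi> \<omega>) \<in> tail (Suc t)"
  shows "(\<lambda>\<omega>. - \<xi> \<omega>) \<in> C t" and "\<xi> \<in> tail (Suc t)"
proof -
  have negA: "(\<lambda>\<omega>. c \<omega> *\<^sub>R - \<xi> \<omega>) \<in> A" if "c \<in> bounded_nonneg (F s)" "s \<le> Suc t" for c s
    using stable_cone_scale_bounded[OF stable_cone_tail that(1) neg] that(2) t
    by (intro tail_subset_attainable) auto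
  have \<xi>L: "\<xi> \<in> L0 (F t)" using \<xi> by (simp add: scalable_claims_iff)
  then show "(\<lambda>\<omega>. - \<xi> \<omega>) \<in> C t"
    using negA[of _ t] by (simp add: scalable_claims_iff L0_def)
  have \<xi>S: "\<xi> \<in> L0 (F (Suc t))" using \<xi>L t by (intro L0_mono[of t "Suc t"]) auto
  have "\<xi> \<in> C (Suc t)"
    unfolding scalable_claims_iff
  proof (intro conjI ballI \<xi>S)
    fix c assume c: "c \<in> bounded_nonneg (F (Suc t))"
    then obtain K0 where K0: "\<forall>\<omega>\<in>space (F (Suc t)). c \<omega> \<le> K0"
      by (auto simp: bounded_nonneg_def)
    \<comment> \<open>The maximum with 0 makes the constant \<open>K\<close> itself an admissible
      multiplier of \<open>\<xi>\<close>.\<close>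
    define K where "K = max K0 0"
    have K: "0 \<le> K" "\<forall>\<omega>\<in>space (F (Suc t)). c \<omega> \<le> K"
      using K0 by (auto simp: K_def max_def)
    have "(\<lambda>\<omega>. K - c \<omega>) \<in> bounded_nonneg (F (Suc t))"
      using c K by (auto simp: bounded_nonneg_def intro!: exI[of _ K])
    then have "(\<lambda>\<omega>. (K - c \<omega>) *\<^sub>R - \<xi> \<omega>) \<in> A"
      by (rule negA) simp
    moreover have "(\<lambda>\<omega>. K *\<^sub>R \<xi> \<omega>) \<in> A"
      using \<xi> bounded_nonneg_const[OF K(1), of "F t"] unfolding scalable_claims_iff by fastforce
    ultimately have "(\<lambda>\<omega>. K *\<^sub>R \<xi> \<omega> + (K - c \<omega>) *\<^sub>R - \<xi> \<omega>) \<in> A"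
      using attainable_add by blast
    then show "(\<lambda>\<omega>. c \<omega> *\<^sub>R \<xi> \<omega>) \<in> A"
      by (simp add: scaleR_diff_left)
  qed
  then show "\<xi> \<in> tail (Suc t)"
    using t by (intro scalable_claims_subset_tail) auto
qed

text \<open>Backward induction from \<open>T\<close>: each step adds \<open>C t\<close> to a closed
  later tail, and \<open>null_claim_reversible\<close> supplies the condition on null strategies in
  \<open>ae_closed_sum\<close>.\<close>

lemma ae_closed_tail:
  assumes C: "\<And>t. t \<le> T \<Longrightarrow> ae_closed M (F t) (C t)" and t: "t \<le> T"
  shows "ae_closed M (F T) (tail t)"
  using t
proof (induction t rule: inc_induct)
  case base
  \<comment> \<open>An element of \<open>tail T\<close> agrees with its single summand only almost
    surely; closedness of \<open>C T\<close> absorbs this.\<close>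
  have "tail T \<subseteq> C T"
    by (auto simp: tail_def intro: ae_closed_AE_eq[OF C])
  then have "tail T = C T" using scalable_claims_subset_tail by auto
  then show ?case using C by simp
next
  case (step t)
  show ?case
    unfolding tail_Suc[OF step(2)]
    using step null_claim_reversible
    by (intro ae_closed_sum[OF _ _ C] subM subF stable_cone_scalable_claims stable_cone_tail) auto
qed

text \<open>For fixed \<open>c\<close>, multiplication preserves almost sure limits, so each
  membership in \<open>A\<close> required by \<open>C t\<close> passes to the limit.\<close>

lemma ae_closed_scalable_claims:
  assumes A: "ae_closed M (F T) A" and t: "t \<le> T"
  shows "ae_closed M (F t) (C t)"
  unfolding ae_closed_def
proof (intro conjI ballI allI impI)
  show "C t \<subseteq> L0 (F t)" by (auto simp: scalable_claims_iff)
  fix X Y assume X: "X \<in> L0 (F t)" and Y: "\<forall>n. Y n \<in> C t"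
    and lim: "AE \<omega> in M. (\<lambda>n. Y n \<omega>) \<longlonglongrightarrow> X \<omega>"
  show "X \<in> C t"
    unfolding scalable_claims_iff
  proof (intro conjI ballI X)
    fix c assume c: "c \<in> bounded_nonneg (F t)"
    show "(\<lambda>\<omega>. c \<omega> *\<^sub>R X \<omega>) \<in> A"
    proof (rule ae_closedD[OF A])
      show "(\<lambda>\<omega>. c \<omega> *\<^sub>R X \<omega>) \<in> L0 (F T)"
        using t c X by (intro L0_mono[OF t] L0_scale) auto
      show "(\<lambda>\<omega>. c \<omega> *\<^sub>R Y n \<omega>) \<in> A" for n
        using Y c by (simp add: scalable_claims_iff)
      show "AE \<omega> in M. (\<lambda>n. c \<omega> *\<^sub>R Y n \<omega>) \<longlonglongrightarrow> c \<omega> *\<^sub>R X \<omega>"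
        using lim by eventually_elim (intro tendsto_intros)
    qed
  qed
qed

end

theorem theorem1p1:
  fixes M :: "'w measure" and T :: nat and F :: "nat \<Rightarrow> 'w measure"
    and \<pi> :: "nat \<Rightarrow> 'w \<Rightarrow> real^'d^'d"
  assumes "prob_space M"
    and "finite_filtration M T F"
    and "bid_ask_process M T F \<pi>"
  shows "closedin (L0_topology M (F T)) (attainable M T F \<pi>) \<longleftrightarrow>
    (\<forall>t\<le>T. closedin (L0_topology M (F t)) (scalable_claims M T F \<pi> t))"
proof -
  interpret trading_model M T F \<pi> by standard fact
  have "ae_closed M (F T) A \<longleftrightarrow> (\<forall>t\<le>T. ae_closed M (F t) (C t))"
    using ae_closed_scalable_claims ae_closed_tail[of 0] tail_zero by auto
  \<comment> \<open>Applied to \<open>C t\<close> at every time, and to \<open>A\<close> at time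
    \<open>T\<close>.\<close>
  moreover have "closedin (L0_topology M (F t)) D \<longleftrightarrow> ae_closed M (F t) D"
    if "t \<le> T" for t and D :: "('w \<Rightarrow> real^'d) set"
    using assms(1) subM[OF that] by (rule closedin_L0_iff_ae_closed)
  ultimately show ?thesis by simp
qed

end
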